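(* Let $X$ be a Banach space over $\mathbb{K}\in\{\mathbb{R},\mathbb{C}\}$, let $\Lambda$ be a nonempty set, and let $X_\lambda$, $\lambda\in\Lambda$, be closed linear subspaces of $X$ forming an absolutely representing family of subspaces (ARFS) in $X$. Then there exists $\varepsilon>0$ with the following property: if a mapping $f:X\to\mathbb{R}$ satisfies $f(0)=0$, is continuous at $0$, and is subadditive, i.e. $f(x+y)\leqslant f(x)+f(y)$ for all $x,y\in X$, then $$\sup_{\lambda\in\Lambda}\|f\upharpoonright_{X_\lambda}\|\geqslant\varepsilon\|f\|.$$
   Context: A family $(X_\lambda)_{\lambda\in\Lambda}$ of closed linear subspaces of $X$ is called an absolutely representing family of subspaces (ARFS) in $X$ if for every $x\in X$ there exist $x_\lambda\in X_\lambda$, $\lambda\in\Lambda$, such that $\sum_{\lambda\in\Lambda}\|x_\lambda\|<\infty$ and $x=\sum_{\lambda\in\Lambda}x_\lambda$. For a (not necessarily linear) mapping $f:X\to\mathbb{R}$ and a closed linear subspace $Y\subset X$ one sets $\|f\upharpoonright_Y\|=\sup_{x\in Y,\,x\neq 0}\frac{f(x)}{\|x\|}$ (no absolute value on $f(x)$), with $\|f\upharpoonright_Y\|=0$ if $Y=\{0\}$; and $\|f\|=\|f\upharpoonright_X\|$. For $f$ as in the statement these quantities lie in $[0,+\infty]$ (the value $+\infty$ is allowed, and the inequality is understood in $[0,+\infty]$). *)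

theory Defs
  imports "HOL-Analysis.Analysis"
begin

text \<open>
  A Banach space over the reals or the complex numbers.  The libraries have no type class of complex
  vector spaces, so the scalar multiplication is an explicit parameter over a scalar type
  of class \<open>real_normed_field\<close>.  By the Gelfand--Mazur theorem such a field is isometrically
  isomorphic to the reals or to the complex numbers, so this is exactly the usual choice of scalars.
  The class \<open>banach\<close> supplies the underlying real Banach space; the first assumption says
  that the scalar multiplication extends its real one, and for \<open>'k = real\<close> it forces
  \<open>smul = scaleR\<close>.
\<close>

locale banach_space_over = vector_space smul
  for smul :: "'k::real_normed_field \<Rightarrow> 'a::banach \<Rightarrow> 'a" +
  assumes scale_of_real: "smul (of_real r) x = r *\<^sub>R x"
    and norm_scale: "norm (smul c x) = norm c * norm x"

definition ARFS ::
  "('k::real_normed_field \<Rightarrow> 'a::banach \<Rightarrow> 'a) \<Rightarrow> 'i set \<Rightarrow> ('i \<Rightarrow> 'a set) \<Rightarrow> bool" where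
  "ARFS smul \<Lambda> X \<longleftrightarrow>
     (\<forall>l\<in>\<Lambda>. module.subspace smul (X l) \<and> closed (X l)) \<and>
     (\<forall>v. \<exists>x. (\<forall>l\<in>\<Lambda>. x l \<in> X l) \<and> (\<lambda>l. norm (x l)) summable_on \<Lambda> \<and> (x has_sum v) \<Lambda>)"

text \<open>
  There is no absolute value on \<open>f x\<close>.  The case distinction is needed because the supremum
  of the empty set of extended reals is \<open>-\<infinity>\<close>.
\<close>

definition restr_norm :: "('a::real_normed_vector \<Rightarrow> real) \<Rightarrow> 'a set \<Rightarrow> ereal" where
  "restr_norm f Y = (if Y = {0} then 0 else (SUP x\<in>{x\<in>Y. x \<noteq> 0}. ereal (f x / norm x)))"

end

theory Submission
  imports Defs
begin

text \<open>
  Let \<open>B\<^sub>c\<close> be the set of vectors that admit an absolutely convergent representation of total norm at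
  most \<open>c\<close>.  The \<open>B\<^sub>n\<close> cover \<open>X\<close>, so by Baire's theorem some \<open>closure B\<^sub>n\<close> contains a ball.  A
  subadditive \<open>f\<close> that is continuous at \<open>0\<close> is continuous everywhere, so if \<open>f x \<le> M * \<parallel>x\<parallel>\<close> on every
  \<open>X\<^sub>\<lambda>\<close>, then \<open>f \<le> M * c\<close> on \<open>closure B\<^sub>c\<close>.  Writing an arbitrary vector as a difference of two points
  of a scaled ball gives the bound on the whole space; unlike in the open mapping theorem, it is
  never necessary to remove the closure.
\<close>

definition abs_rep :: "'i set \<Rightarrow> ('i \<Rightarrow> 'a::real_normed_vector set) \<Rightarrow> real \<Rightarrow> 'a set" where
  "abs_rep \<Lambda> X c = {v. \<exists>x. (\<forall>l\<in>\<Lambda>. x l \<in> X l) \<and>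
     (\<forall>F. finite F \<and> F \<subseteq> \<Lambda> \<longrightarrow> (\<Sum>l\<in>F. norm (x l)) \<le> c) \<and> (x has_sum v) \<Lambda>}"

lemma scaleR_abs_rep_subset:
  assumes "\<And>l r x. l \<in> \<Lambda> \<Longrightarrow> x \<in> X l \<Longrightarrow> r *\<^sub>R x \<in> X l"
  shows "(*\<^sub>R) s ` abs_rep \<Lambda> X c \<subseteq> abs_rep \<Lambda> X (\<bar>s\<bar> * c)"
proof (rule image_subsetI)
  fix v assume "v \<in> abs_rep \<Lambda> X c"
  then obtain x where x: "\<forall>l\<in>\<Lambda>. x l \<in> X l" "(x has_sum v) \<Lambda>"
      and c: "\<And>F. finite F \<Longrightarrow> F \<subseteq> \<Lambda> \<Longrightarrow> (\<Sum>l\<in>F. norm (x l)) \<le> c"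
    by (auto simp: abs_rep_def)
  have "(\<Sum>l\<in>F. norm (s *\<^sub>R x l)) \<le> \<bar>s\<bar> * c" if "finite F" "F \<subseteq> \<Lambda>" for F
    using mult_left_mono[OF c[OF that], of "\<bar>s\<bar>"] by (simp add: sum_distrib_left)
  moreover have "((\<lambda>l. s *\<^sub>R x l) has_sum s *\<^sub>R v) \<Lambda>"
    using x(2) by (rule has_sum_scaleR)
  ultimately show "s *\<^sub>R v \<in> abs_rep \<Lambda> X (\<bar>s\<bar> * c)"
    using assms x(1) by (auto simp: abs_rep_def intro!: exI[of _ "\<lambda>l. s *\<^sub>R x l"])
qed

text \<open>Closure commutes with scaling. Negative \<open>s\<close> is included, so that a
  difference of two points can be treated as a sum, to which subadditivity applies.\<close>

lemma scaleR_closure_abs_rep: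
  assumes "\<And>l r x. l \<in> \<Lambda> \<Longrightarrow> x \<in> X l \<Longrightarrow> r *\<^sub>R x \<in> X l" and "v \<in> closure (abs_rep \<Lambda> X c)"
  shows "s *\<^sub>R v \<in> closure (abs_rep \<Lambda> X (\<bar>s\<bar> * c))"
  using closure_mono[OF scaleR_abs_rep_subset[of \<Lambda> X s c]] assms
  by (auto simp flip: closure_scaleR)

lemma ex_ball_subset_closure_of_cover:
  fixes B :: "nat \<Rightarrow> 'a::banach set"
  assumes "(\<Union>n. B n) = UNIV"
  obtains n v r where "r > 0" "ball v r \<subseteq> closure (B n)"
proof -
  have "\<exists>n. interior (closure (B n)) \<noteq> {}"
  proof (rule ccontr)
    assume *: "\<not> ?thesis"
    have "euclidean interior_of \<Union>(range (\<lambda>n. closure (B n))) = {}"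
      using * by (intro Baire_category_alt disjI1 completely_metrizable_space_euclidean) auto
    moreover have "(\<Union>n. B n) \<subseteq> (\<Union>n. closure (B n))"
      by (intro UN_mono closure_subset order_refl)
    ultimately show False using assms by (simp add: top_unique)
  qed
  then obtain n v where "v \<in> interior (closure (B n))" by blast
  then show thesis
    using that by (meson mem_interior)
qed

text \<open>Splitting \<open>a + h\<close>, and \<open>a\<close> as \<open>(a + h) + (- h)\<close>,
  squeezes \<open>f (a + h)\<close> between \<open>f a - f (- h)\<close> and
  \<open>f a + f h\<close>. Both bounds tend to \<open>f a\<close> by continuity at
  \<open>0\<close>.\<close>

lemma isCont_of_subadditive:
  fixes f :: "'a::real_normed_vector \<Rightarrow> real"
  assumes f0: "f 0 = 0" and cont: "isCont f 0" and subadd: "\<And>x y. f (x + y) \<le> f x + f y"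
  shows "isCont f a"
proof -
  have f: "(f \<longlongrightarrow> 0) (at 0)"
    using cont f0 by (simp add: isCont_def)
  have "isCont (\<lambda>h. f (- h)) 0"
    using isCont_o2[OF isCont_minus[OF continuous_ident], of 0 f] cont by simp
  then have "((\<lambda>h. f (- h)) \<longlongrightarrow> 0) (at 0)"
    using f0 by (simp add: isCont_def)
  then have lo: "((\<lambda>h. f a - f (- h)) \<longlongrightarrow> f a) (at 0)"
    by (auto intro!: tendsto_eq_intros)
  have hi: "((\<lambda>h. f a + f h) \<longlongrightarrow> f a) (at 0)"
    using f by (auto intro!: tendsto_eq_intros)
  have "f a - f (- h) \<le> f (a + h)" for h
    using subadd[of "a + h" "- h"] by simp
  then have "((\<lambda>h. f (a + h)) \<longlongrightarrow> f a) (at 0)"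
    using subadd by (intro tendsto_sandwich[OF _ _ lo hi]) auto
  then show ?thesis
    by (simp add: isCont_iff)
qed

lemma subadditive_sum_le:
  fixes f :: "'a::comm_monoid_add \<Rightarrow> real"
  assumes "f 0 = 0" and "\<And>x y. f (x + y) \<le> f x + f y"
  shows "f (sum x F) \<le> (\<Sum>l\<in>F. f (x l))"
proof (induction F rule: infinite_finite_induct)
  case (insert l F)
  then show ?case using assms(2)[of "x l" "sum x F"] by simp
qed (simp_all add: assms(1))

text \<open>Since \<open>abs_rep\<close> bounds the finite partial sums of the norms, finite
  subadditivity gives \<open>f (sum x F) \<le> M * c\<close> directly. Continuity of
  \<open>f\<close> then carries the bound twice to a limit: along the net of finite subsets
  \<open>F\<close>, and from \<open>abs_rep\<close> to its closure.\<close>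

lemma subadditive_le_on_closure_abs_rep:
  fixes f :: "'a::real_normed_vector \<Rightarrow> real"
  assumes f: "f 0 = 0" "isCont f 0" "\<And>x y. f (x + y) \<le> f x + f y"
    and M: "0 \<le> M" "\<And>l x. l \<in> \<Lambda> \<Longrightarrow> x \<in> X l \<Longrightarrow> f x \<le> M * norm x"
    and v: "v \<in> closure (abs_rep \<Lambda> X c)"
  shows "f v \<le> M * c"
proof (rule continuous_le_on_closure[OF _ v])
  have cont: "isCont f a" for a
    using f by (rule isCont_of_subadditive)
  then show "continuous_on (closure (abs_rep \<Lambda> X c)) f"
    by (simp add: continuous_at_imp_continuous_on)
  fix u assume "u \<in> abs_rep \<Lambda> X c"
  then obtain x where x: "\<And>l. l \<in> \<Lambda> \<Longrightarrow> x l \<in> X l" "(x has_sum u) \<Lambda>"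
      and c: "\<And>F. finite F \<Longrightarrow> F \<subseteq> \<Lambda> \<Longrightarrow> (\<Sum>l\<in>F. norm (x l)) \<le> c"
    by (auto simp: abs_rep_def)
  have "f (sum x F) \<le> M * c" if F: "finite F" "F \<subseteq> \<Lambda>" for F
  proof -
    have "f (sum x F) \<le> (\<Sum>l\<in>F. f (x l))"
      using f by (intro subadditive_sum_le)
    also have "\<dots> \<le> (\<Sum>l\<in>F. M * norm (x l))"
      using F x(1) by (intro sum_mono M(2)) auto
    also have "\<dots> \<le> M * c"
      using mult_left_mono[OF c[OF F] M(1)] by (simp add: sum_distrib_left)
    finally show ?thesis .
  qed
  then have "\<forall>\<^sub>F F in finite_subsets_at_top \<Lambda>. f (sum x F) \<le> M * c"
    by (intro eventually_finite_subsets_at_top_weakI)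
  moreover have "((\<lambda>F. f (sum x F)) \<longlongrightarrow> f u) (finite_subsets_at_top \<Lambda>)"
    using x(2) cont by (auto simp: has_sum_def intro: isCont_tendsto_compose)
  ultimately show "f u \<le> M * c"
    by (intro tendsto_upperbound) auto
qed

text \<open>With no absolute value in \<open>restr_norm\<close>, the sign is not automatic. It comes
  from \<open>0 = f (x + - x) \<le> f x + f (- x)\<close>: one of the two values is nonnegative, and
  \<open>Y\<close> contains both points.\<close>

lemma restr_norm_nonneg:
  fixes f :: "'a::real_normed_vector \<Rightarrow> real"
  assumes "f 0 = 0" "\<And>x y. f (x + y) \<le> f x + f y" and "0 \<in> Y" "\<And>x. x \<in> Y \<Longrightarrow> - x \<in> Y"
  shows "0 \<le> restr_norm f Y"
proof (cases "Y = {0}")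
  case False
  then obtain x where x: "x \<in> Y" "x \<noteq> 0" using assms(3) by blast
  have "0 \<le> f x \<or> 0 \<le> f (- x)"
    using assms(1) assms(2)[of x "- x"] by auto
  then obtain y where y: "y \<in> Y" "y \<noteq> 0" "0 \<le> f y"
    using x assms(4) by fastforce
  then have "ereal (f y / norm y) \<le> restr_norm f Y"
    using False by (auto simp: restr_norm_def intro!: SUP_upper)
  moreover have "0 \<le> ereal (f y / norm y)" using y by simp
  ultimately show ?thesis by (rule order_trans[rotated])
qed (simp add: restr_norm_def)

lemma restr_norm_leD:
  assumes "restr_norm f Y \<le> ereal M" "f 0 = 0" "x \<in> Y"
  shows "f x \<le> M * norm x"
proof (cases "x = 0")
  case False
  then have "ereal (f x / norm x) \<le> restr_norm f Y"
    using assms(3) by (auto simp: restr_norm_def intro!: SUP_upper)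
  then have "f x / norm x \<le> M" using assms(1) by (metis ereal_less_eq(3) order_trans)
  then show ?thesis using False by (simp add: divide_le_eq)
qed (simp add: assms(2))

lemma restr_norm_le:
  assumes "0 \<le> C" "\<And>x. x \<in> Y \<Longrightarrow> f x \<le> C * norm x"
  shows "restr_norm f Y \<le> ereal C"
  using assms by (auto simp: restr_norm_def divide_le_eq intro!: SUP_least)

theorem theorem5p1:
  fixes smul :: "'k::real_normed_field \<Rightarrow> 'a::banach \<Rightarrow> 'a"
    and \<Lambda> :: "'i set"
    and X :: "'i \<Rightarrow> 'a set"
  assumes "banach_space_over smul"
    and "\<Lambda> \<noteq> {}"
    and "ARFS smul \<Lambda> X"
  shows "\<exists>\<epsilon>::real. \<epsilon> > 0 \<and>
    (\<forall>f :: 'a \<Rightarrow> real.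
       f 0 = 0 \<and> isCont f 0 \<and> (\<forall>x y. f (x + y) \<le> f x + f y) \<longrightarrow>
       (SUP l\<in>\<Lambda>. restr_norm f (X l)) \<ge> ereal \<epsilon> * restr_norm f UNIV)"
proof -
  interpret banach_space_over smul by fact
  have sub: "subspace (X l)" if "l \<in> \<Lambda>" for l
    using assms(3) that by (simp add: ARFS_def)
  \<comment> \<open>The \<open>X l\<close> are subspaces over \<open>'k\<close>; real scalars act on
    them through \<open>of_real\<close>.\<close>
  have scale: "r *\<^sub>R x \<in> X l" if "l \<in> \<Lambda>" "x \<in> X l" for l r x
    using subspace_scale[OF sub[OF that(1)] that(2), of "of_real r"] by (simp add: scale_of_real)
  have "v \<in> (\<Union>n. abs_rep \<Lambda> X (real n))" for v
  proof -
    obtain x where x: "\<forall>l\<in>\<Lambda>. x l \<in> X l" "(\<lambda>l. norm (x l)) summable_on \<Lambda>" "(x has_sum v) \<Lambda>"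
      using assms(3) unfolding ARFS_def by blast
    \<comment> \<open>Rounding the total norm up to a natural number makes the cover countable, as
      Baire's theorem requires.\<close>
    obtain n where n: "(\<Sum>\<^sub>\<infinity>l\<in>\<Lambda>. norm (x l)) \<le> real n"
      using real_arch_simple by blast
    have "(\<Sum>l\<in>F. norm (x l)) \<le> real n" if "finite F" "F \<subseteq> \<Lambda>" for F
      by (rule order_trans[OF finite_sum_le_infsum[OF x(2) that] n]) simp
    then show ?thesis using x by (auto simp: abs_rep_def)
  qed
  then have "(\<Union>n. abs_rep \<Lambda> X (real n)) = UNIV" by blast
  then obtain n v r where r: "r > 0" and ball: "ball v r \<subseteq> closure (abs_rep \<Lambda> X (real n))"
    by (rule ex_ball_subset_closure_of_cover)
  \<comment> \<open>\<open>K\<close> is fixed before \<open>f\<close>, so \<open>1 / K\<close>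
    serves for all \<open>f\<close>. The estimate below produces \<open>4 * n / r\<close>; using
    \<open>n + 1\<close> keeps \<open>K\<close> positive even when \<open>n = 0\<close>.\<close>
  define K where "K = 4 * (real n + 1) / r"
  have K: "K > 0" using r by (simp add: K_def)
  have le: "(SUP l\<in>\<Lambda>. restr_norm f (X l)) \<ge> ereal (1 / K) * restr_norm f UNIV"
    if f: "f 0 = 0" "isCont f 0" and subadd: "\<And>x y. f (x + y) \<le> f x + f y" for f :: "'a \<Rightarrow> real"
  proof -
    let ?S = "SUP l\<in>\<Lambda>. restr_norm f (X l)"
    obtain l where l: "l \<in> \<Lambda>" using assms(2) by blast
    have "0 \<le> restr_norm f (X l)"
      using f(1) subadd subspace_0[OF sub[OF l]] subspace_neg[OF sub[OF l]]
      by (intro restr_norm_nonneg)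
    also have "\<dots> \<le> ?S" using l by (rule SUP_upper)
    finally have S: "0 \<le> ?S" .
    show ?thesis
    \<comment> \<open>Only a finite supremum needs work: for plus infinity the inequality is
      trivial, and \<open>S\<close> rules out minus infinity.\<close>
    proof (cases ?S)
      case (real M)
      have M: "0 \<le> M" using S real by simp
      have *: "f x \<le> M * norm x" if "l \<in> \<Lambda>" "x \<in> X l" for l x
        using SUP_upper[OF that(1), of "\<lambda>l. restr_norm f (X l)"] real f(1) that(2)
        by (intro restr_norm_leD[of f "X l"]) auto
      have cl: "f u \<le> M * c" if "u \<in> closure (abs_rep \<Lambda> X c)" for u c
        using f subadd M * that by (rule subadditive_le_on_closure_abs_rep)
      have "f z \<le> M * K * norm z" for z
      proof (cases "z = 0")
        case False
        \<comment> \<open>With this \<open>t\<close> the vector \<open>(1 / t) *\<^sub>R z\<close>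
          has norm \<open>r / 2\<close>, so adding it to the centre \<open>v\<close> stays inside
          the open ball.\<close>
        define t where "t = 2 * norm z / r"
        have t: "t > 0" using False r by (simp add: t_def)
        have "v + (1 / t) *\<^sub>R z \<in> ball v r" "v \<in> ball v r"
          using False r by (auto simp: t_def dist_norm)
        then have "t *\<^sub>R (v + (1 / t) *\<^sub>R z) \<in> closure (abs_rep \<Lambda> X (\<bar>t\<bar> * real n))"
            "(- t) *\<^sub>R v \<in> closure (abs_rep \<Lambda> X (\<bar>- t\<bar> * real n))"
          using ball by (blast intro: scaleR_closure_abs_rep scale)+
        then have "f (t *\<^sub>R (v + (1 / t) *\<^sub>R z)) + f ((- t) *\<^sub>R v) \<le> M * (t * n) + M * (t * n)"
          using t by (intro add_mono cl) simp_all
        moreover have "z = t *\<^sub>R (v + (1 / t) *\<^sub>R z) + (- t) *\<^sub>R v"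
          using t by (simp add: algebra_simps)
        ultimately have "f z \<le> M * (2 * t * n)"
          using subadd[of "t *\<^sub>R (v + (1 / t) *\<^sub>R z)" "(- t) *\<^sub>R v"] by simp
        also have "\<dots> \<le> M * (K * norm z)"
          using r M by (intro mult_left_mono) (simp_all add: t_def K_def field_simps)
        finally show ?thesis by simp
      qed (simp add: f)
      then have "restr_norm f UNIV \<le> ereal (M * K)"
        using M K by (intro restr_norm_le) auto
      then have "ereal (1 / K) * restr_norm f UNIV \<le> ereal (1 / K) * ereal (M * K)"
        using K by (intro ereal_mult_left_mono) auto
      then show ?thesis using K real by simp
    qed (use S in auto)
  qed
  show ?thesis
    using K le by (intro exI[of _ "1 / K"]) simp
qed

end
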